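(* For every $n$ there exists a bipartite graph $G$ with $O(n)$ vertices and $O(n)$ edges such that the induced matching polytope of $G$ has extension complexity $2^{\Omega(\sqrt[4]{n})}$.
   Context: A matching in a graph $G=(V,E)$ is a set of pairwise vertex-disjoint edges; it is induced if no edge of $G$ joins two distinct edges of the matching. The induced matching polytope of $G$ is the convex hull of the 0/1 incidence vectors in $\mathbb{R}^E$ of all induced matchings of $G$. The extension complexity $\mathrm{xc}(Q)$ of a polytope $Q$ is the minimum number of facets of a polytope $Q'$ such that $Q$ is a linear image of $Q'$. *)

theory Defs
  imports Complex_Main
begin

definition simple_graph :: "nat set \<Rightarrow> nat set set \<Rightarrow> bool" where
  "simple_graph V E \<longleftrightarrow> finite V \<and>
     (\<forall>e\<in>E. \<exists>u v. u \<in> V \<and> v \<in> V \<and> u \<noteq> v \<and> e = {u, v})"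

definition bipartite :: "nat set \<Rightarrow> nat set set \<Rightarrow> bool" where
  "bipartite V E \<longleftrightarrow> (\<exists>A. A \<subseteq> V \<and> (\<forall>e\<in>E. card (e \<inter> A) = 1))"

definition matching :: "nat set set \<Rightarrow> nat set set \<Rightarrow> bool" where
  "matching E M \<longleftrightarrow> M \<subseteq> E \<and> (\<forall>e1\<in>M. \<forall>e2\<in>M. e1 \<noteq> e2 \<longrightarrow> e1 \<inter> e2 = {})"

definition induced_matching :: "nat set set \<Rightarrow> nat set set \<Rightarrow> bool" where
  "induced_matching E M \<longleftrightarrow> matching E M \<and>
     (\<forall>e1\<in>M. \<forall>e2\<in>M. e1 \<noteq> e2 \<longrightarrow> \<not> (\<exists>f\<in>E. f \<inter> e1 \<noteq> {} \<and> f \<inter> e2 \<noteq> {}))"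

text \<open>Vectors are functions from an index type to the reals; R^E is modelled by
  functions nat set => real that vanish outside E (automatic for the
  points we use), and R^d by functions nat => real vanishing at indices \<ge> d.\<close>

definition cvx_hull :: "('i \<Rightarrow> real) set \<Rightarrow> ('i \<Rightarrow> real) set" where
  "cvx_hull X = {y. \<exists>S l. finite S \<and> S \<subseteq> X \<and> S \<noteq> {} \<and> (\<forall>p\<in>S. l p \<ge> 0) \<and> sum l S = 1 \<and>
                          y = (\<lambda>j. \<Sum>p\<in>S. l p * p j)}"

definition vecs :: "nat \<Rightarrow> (nat \<Rightarrow> real) set" where
  "vecs d = {x. \<forall>i\<ge>d. x i = 0}"

definition polytope_in :: "nat \<Rightarrow> (nat \<Rightarrow> real) set \<Rightarrow> bool" where
  "polytope_in d Q \<longleftrightarrow> (\<exists>P. finite P \<and> P \<subseteq> vecs d \<and> Q = cvx_hull P)"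

definition face_in :: "nat \<Rightarrow> (nat \<Rightarrow> real) set \<Rightarrow> (nat \<Rightarrow> real) set \<Rightarrow> bool" where
  "face_in d F Q \<longleftrightarrow> (\<exists>a b. (\<forall>x\<in>Q. (\<Sum>i<d. a i * x i) \<le> b) \<and>
                             F = {x\<in>Q. (\<Sum>i<d. a i * x i) = b})"

definition aff_indep :: "('i \<Rightarrow> real) set \<Rightarrow> bool" where
  "aff_indep P \<longleftrightarrow> finite P \<and>
     (\<forall>\<mu>. sum \<mu> P = 0 \<and> (\<forall>j. (\<Sum>p\<in>P. \<mu> p * p j) = 0) \<longrightarrow> (\<forall>p\<in>P. \<mu> p = 0))"

definition affdim :: "('i \<Rightarrow> real) set \<Rightarrow> int" where
  "affdim S = (if S = {} then -1
               else int (GREATEST m. \<exists>P. P \<subseteq> S \<and> aff_indep P \<and> card P = Suc m))"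

definition facet_in :: "nat \<Rightarrow> (nat \<Rightarrow> real) set \<Rightarrow> (nat \<Rightarrow> real) set \<Rightarrow> bool" where
  "facet_in d F Q \<longleftrightarrow> face_in d F Q \<and> F \<noteq> {} \<and> affdim F = affdim Q - 1"

definition xc :: "('e \<Rightarrow> real) set \<Rightarrow> nat" where
  "xc Q = (LEAST k. \<exists>d Q' (M :: 'e \<Rightarrow> nat \<Rightarrow> real).
              polytope_in d Q' \<and>
              Q = (\<lambda>x e. \<Sum>i<d. M e i * x i) ` Q' \<and>
              card {F. facet_in d F Q'} = k)"

definition incidence :: "nat set set \<Rightarrow> (nat set \<Rightarrow> real)" where
  "incidence M = (\<lambda>e. if e \<in> M then 1 else 0)"

definition induced_matching_polytope :: "nat set set \<Rightarrow> (nat set \<Rightarrow> real) set" where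
  "induced_matching_polytope E = cvx_hull {incidence M | M. induced_matching E M}"

end

theory Submission
  imports Defs "HOL-Library.Function_Algebras" "HOL-Library.Nat_Bijection"
begin

text \<open>Let \<open>Q'\<close> be an extension. The face of \<open>Q'\<close> above a tight valid inequality is the intersection of the
  facets containing it, so assigning to every facet the inequalities whose face it contains and the
  points it misses covers the support of any slack matrix by as many rectangles as \<open>Q'\<close> has facets.
  For a bipartite graph with \<open>O(k\<^sup>2)\<close> vertices and edges there are inequalities and induced
  matchings, both indexed by subsets \<open>a\<close>, \<open>b\<close> of \<open>{..<k}\<close>, whose slack vanishes iff
  \<open>card (a \<inter> b) \<in> {1, 2}\<close>. A rectangle without pairs of intersection size 1 contains at most \<open>2 ^ k\<close> of
  the \<open>3 ^ k\<close> disjoint pairs, so about \<open>(3 / 2) ^ k\<close> facets are needed.\<close>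

subsection \<open>Polytopes and their faces\<close>

lemma cvx_hull_superset: "X \<subseteq> cvx_hull X"
proof
  fix x assume "x \<in> X"
  then show "x \<in> cvx_hull X"
    unfolding cvx_hull_def by (intro CollectI exI[of _ "{x}"] exI[of _ "\<lambda>_. 1"]) auto
qed

text \<open>Padding the coefficients with 0 outside their support puts all combinations over the one
  index set \<open>X\<close>.\<close>

lemma cvx_hull_finite:
  assumes "finite X"
  shows "cvx_hull X = {y. \<exists>l. (\<forall>p\<in>X. l p \<ge> 0) \<and> sum l X = 1 \<and> y = (\<lambda>j. \<Sum>p\<in>X. l p * p j)}"
    (is "_ = ?R")
proof (intro subset_antisym subsetI)
  fix y assume "y \<in> cvx_hull X"
  then obtain S l where S: "S \<subseteq> X" "\<forall>p\<in>S. l p \<ge> 0" "sum l S = 1" "y = (\<lambda>j. \<Sum>p\<in>S. l p * p j)"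
    unfolding cvx_hull_def by blast
  have eq: "X \<inter> S = S" using S(1) by auto
  have *: "(\<Sum>p\<in>X. (if p \<in> S then l p else 0) * g p) = (\<Sum>p\<in>S. l p * g p)" for g
    using sum.inter_restrict[OF assms, of "\<lambda>p. l p * g p" S] unfolding eq
    by (simp add: if_distrib[of "\<lambda>x. x * _"] cong: if_cong)
  show "y \<in> ?R"
    using S *[of "\<lambda>_. 1"] by (intro CollectI exI[of _ "\<lambda>p. if p \<in> S then l p else 0"]) (auto simp: *)
next
  fix y assume "y \<in> ?R"
  then obtain l where l: "\<forall>p\<in>X. l p \<ge> 0" "sum l X = 1" "y = (\<lambda>j. \<Sum>p\<in>X. l p * p j)"
    by blast
  then show "y \<in> cvx_hull X"
    unfolding cvx_hull_def using assms by (intro CollectI exI[of _ X] exI[of _ l]) auto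
qed

text \<open>The index set \<open>I\<close> stays general: the bound serves the coordinates
  \<open>i < d\<close> of an extension as well as the edges of a graph.\<close>

lemma cvx_hull_le:
  assumes "y \<in> cvx_hull X" "\<And>p. p \<in> X \<Longrightarrow> (\<Sum>i\<in>I. a i * p i) \<le> b"
  shows "(\<Sum>i\<in>I. a i * y i) \<le> b"
proof -
  obtain S l where S: "S \<subseteq> X" "\<forall>p\<in>S. l p \<ge> 0" "sum l S = 1" "y = (\<lambda>j. \<Sum>p\<in>S. l p * p j)"
    using assms(1) unfolding cvx_hull_def by blast
  have "(\<Sum>i\<in>I. a i * y i) = (\<Sum>p\<in>S. l p * (\<Sum>i\<in>I. a i * p i))"
    unfolding S(4) sum_distrib_left by (subst sum.swap) (simp add: mult_ac)
  also have "\<dots> \<le> (\<Sum>p\<in>S. l p * b)"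
    using S(1,2) assms(2) by (intro sum_mono mult_left_mono) auto
  also have "\<dots> = b" using S(3) by (simp flip: sum_distrib_right)
  finally show ?thesis .
qed

lemma cvx_hull_subset_vecs:
  assumes "X \<subseteq> vecs d"
  shows "cvx_hull X \<subseteq> vecs d"
proof
  fix y assume "y \<in> cvx_hull X"
  then obtain S l where S: "S \<subseteq> X" "y = (\<lambda>j. \<Sum>p\<in>S. l p * p j)"
    unfolding cvx_hull_def by blast
  then show "y \<in> vecs d"
    using assms unfolding vecs_def by (auto intro!: sum.neutral)
qed

text \<open>A convex combination attains the maximum \<open>b\<close> only if every point of nonzero
  weight does. So a face is determined by the generators in it, which leaves finitely many
  faces.\<close>

lemma face_in_cvx_hull:
  assumes "finite X" "face_in d F (cvx_hull X)"
  shows "F = cvx_hull (X \<inter> F)"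
proof -
  obtain a b where ab: "\<And>x. x \<in> cvx_hull X \<Longrightarrow> (\<Sum>i<d. a i * x i) \<le> b"
    and F: "F = {x \<in> cvx_hull X. (\<Sum>i<d. a i * x i) = b}"
    using assms(2) unfolding face_in_def by blast
  define h where "h x = (\<Sum>i<d. a i * x i)" for x
  have h_comb: "h (\<lambda>j. \<Sum>p\<in>S. l p * p j) = (\<Sum>p\<in>S. l p * h p)" for S l
    unfolding h_def sum_distrib_left by (subst sum.swap) (simp add: mult_ac)
  have XF: "X \<inter> F = {p \<in> X. h p = b}"
    using cvx_hull_superset[of X] unfolding F h_def by auto
  have le: "p \<in> X \<Longrightarrow> h p \<le> b" for p
    using ab cvx_hull_superset[of X] unfolding h_def by auto
  show ?thesis
  proof (intro subset_antisym subsetI)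
    fix y assume y: "y \<in> F"
    then obtain S l where S: "finite S" "S \<subseteq> X" "\<forall>p\<in>S. l p \<ge> 0" "sum l S = 1"
      "y = (\<lambda>j. \<Sum>p\<in>S. l p * p j)"
      unfolding F cvx_hull_def by blast
    define S' where "S' = {p \<in> S. l p \<noteq> 0}"
    have "h y = b" using y unfolding F h_def by simp
    then have "(\<Sum>p\<in>S. l p * (b - h p)) = 0"
      unfolding S(5) h_comb using S(4) by (simp add: right_diff_distrib sum_subtractf flip: sum_distrib_right)
    then have "\<forall>p\<in>S. l p * (b - h p) = 0"
      using S(1,2,3) le by (subst (asm) sum_nonneg_eq_0_iff) auto
    then have "S' \<subseteq> X \<inter> F" unfolding XF S'_def using S(2) by auto
    moreover have "sum l S' = sum l S"
      unfolding S'_def using S(1) by (intro sum.mono_neutral_left) auto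
    moreover have "(\<Sum>p\<in>S'. l p * p j) = (\<Sum>p\<in>S. l p * p j)" for j
      unfolding S'_def using S(1) by (intro sum.mono_neutral_left) auto
    moreover have "S' \<noteq> {}" using S(4) calculation(2) by auto
    ultimately show "y \<in> cvx_hull (X \<inter> F)"
      unfolding cvx_hull_def using S
      by (intro CollectI exI[of _ S'] exI[of _ l]) (auto simp: S'_def)
  next
    fix y assume "y \<in> cvx_hull (X \<inter> F)"
    then obtain S l where S: "finite S" "S \<subseteq> X \<inter> F" "\<forall>p\<in>S. l p \<ge> 0" "sum l S = 1" "S \<noteq> {}"
      "y = (\<lambda>j. \<Sum>p\<in>S. l p * p j)"
      unfolding cvx_hull_def by blast
    then have "y \<in> cvx_hull X" unfolding cvx_hull_def by blast
    moreover have "h y = (\<Sum>p\<in>S. l p * b)"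
      unfolding S(6) h_comb using S(2) unfolding XF by (intro sum.cong) auto
    ultimately show "y \<in> F"
      unfolding F h_def[symmetric] using S(4) by (simp flip: sum_distrib_right)
  qed
qed

lemma finite_faces:
  assumes "polytope_in d Q"
  shows "finite {F. face_in d F Q}"
proof -
  obtain X where X: "finite X" "Q = cvx_hull X"
    using assms unfolding polytope_in_def by blast
  have "{F. face_in d F Q} \<subseteq> cvx_hull ` Pow X"
    using face_in_cvx_hull[OF X(1)] unfolding X(2) by blast
  then show ?thesis using X(1) by (meson finite_Pow_iff finite_imageI finite_subset)
qed

subsection \<open>Affine dimension\<close>

text \<open>The interpretation declares \<open>scale_scale\<close> as a simp rule; were the scaling an abstraction instead of
  a constant, this rule would match products of reals and loop with \<open>algebra_simps\<close>.\<close>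

definition fscale :: "real \<Rightarrow> (nat \<Rightarrow> real) \<Rightarrow> nat \<Rightarrow> real" where
  "fscale r x = (\<lambda>i. r * x i)"

lemma fscale_apply [simp]: "fscale r x i = r * x i"
  by (simp add: fscale_def)

interpretation fv: vector_space fscale
  by unfold_locales (auto simp: algebra_simps fun_eq_iff)

lemma sum_fun_apply: "sum f A i = (\<Sum>x\<in>A. f x i)" for f :: "'a \<Rightarrow> 'b \<Rightarrow> 'c :: comm_monoid_add"
  by (induction A rule: infinite_finite_induct) auto

definition unit_fun :: "nat \<Rightarrow> nat \<Rightarrow> real" where
  "unit_fun i = (\<lambda>j. if j = i then 1 else 0)"

text \<open>Homogenization, with the coordinate \<open>d\<close>, which vanishes on \<open>vecs d\<close>, set to 1.\<close>

definition homog :: "nat \<Rightarrow> (nat \<Rightarrow> real) \<Rightarrow> nat \<Rightarrow> real" where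
  "homog d x = x(d := 1)"

lemma inj_on_homog: "inj_on (homog d) (vecs d)"
proof (rule inj_onI)
  fix x y assume xy: "x \<in> vecs d" "y \<in> vecs d" "homog d x = homog d y"
  have "x d = y d" using xy(1,2) by (simp add: vecs_def)
  then have "x = (homog d x)(d := y d)" unfolding homog_def by (simp flip: \<open>x d = y d\<close>)
  also have "\<dots> = y" unfolding xy(3) by (simp add: homog_def)
  finally show "x = y" .
qed

lemma homog_eq_sum: 
  assumes "x \<in> vecs d"
  shows "homog d x = (\<Sum>i<d. fscale (x i) (unit_fun i)) + unit_fun d"
proof
  fix j
  have "(\<Sum>i<d. x i * unit_fun i j) = (\<Sum>i<d. if i = j then x i else 0)"
    by (intro sum.cong) (auto simp: unit_fun_def)
  also have "\<dots> = (if j < d then x j else 0)" by simp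
  finally show "homog d x j = ((\<Sum>i<d. fscale (x i) (unit_fun i)) + unit_fun d) j"
    using assms unfolding plus_fun_apply sum_fun_apply by (simp add: homog_def unit_fun_def vecs_def)
qed

text \<open>In a linear relation between homogenized points, coordinate \<open>d\<close> says that
  the coefficients sum to 0; the other coordinates give the relation between the points.\<close>

lemma aff_indep_iff_independent_homog:
  assumes "P \<subseteq> vecs d"
  shows "aff_indep P \<longleftrightarrow> finite P \<and> fv.independent (homog d ` P)"
proof (cases "finite P")
  case True
  have inj: "inj_on (homog d) P" using inj_on_homog assms by (rule inj_on_subset)
  \<comment> \<open>\<open>\<mu>\<close> weights points and \<open>u\<close> their homogenizations;
    keeping both free lets either be built from the other below.\<close>
  have eq: "(sum \<mu> P = 0 \<and> (\<forall>j. (\<Sum>p\<in>P. \<mu> p * p j) = 0)) \<longleftrightarrow>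
      (\<Sum>v\<in>homog d ` P. fscale (u v) v) = 0" if "\<And>p. p \<in> P \<Longrightarrow> u (homog d p) = \<mu> p" for \<mu> u
  proof -
    have 1: "(\<Sum>v\<in>homog d ` P. u v * v j) = (if j = d then sum \<mu> P else (\<Sum>p\<in>P. \<mu> p * p j))" for j
      using that by (simp add: sum.reindex[OF inj]) (simp add: homog_def)
    have 2: "(\<Sum>p\<in>P. \<mu> p * p d) = 0" using assms by (auto simp: vecs_def intro!: sum.neutral)
    show ?thesis unfolding fun_eq_iff sum_fun_apply fscale_apply 1 using 2 by (auto split: if_splits)
  qed
  show ?thesis
  proof
    assume ai: "aff_indep P"
    show "finite P \<and> fv.independent (homog d ` P)"
    proof (intro conjI True notI)
      assume "fv.dependent (homog d ` P)"
      then obtain u where u: "\<exists>v\<in>homog d ` P. u v \<noteq> 0" "(\<Sum>v\<in>homog d ` P. fscale (u v) v) = 0"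
        using fv.dependent_finite[of "homog d ` P"] True by auto
      then show False using eq[of u "\<lambda>p. u (homog d p)"] ai unfolding aff_indep_def by auto
    qed
  next
    assume ind: "finite P \<and> fv.independent (homog d ` P)"
    show "aff_indep P" unfolding aff_indep_def
    proof (intro conjI True allI impI)
      fix \<mu> assume \<mu>: "sum \<mu> P = 0 \<and> (\<forall>j. (\<Sum>p\<in>P. \<mu> p * p j) = 0)"
      define u where "u v = \<mu> (the_inv_into P (homog d) v)" for v
      have u: "u (homog d p) = \<mu> p" if "p \<in> P" for p
        unfolding u_def using that inj by (simp add: the_inv_into_f_f)
      have "(\<Sum>v\<in>homog d ` P. fscale (u v) v) = 0" using eq[of u \<mu>] u \<mu> by blast
      then have "\<forall>v\<in>homog d ` P. u v = 0"
        using fv.dependent_finite[of "homog d ` P"] ind by blast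
      then show "\<forall>p\<in>P. \<mu> p = 0" using u by simp
    qed
  qed
qed (auto simp: aff_indep_def)

text \<open>The ambient function space has infinite dimension; finiteness holds because
  \<open>d + 1\<close> unit functions span all homogenized points of \<open>vecs d\<close>.\<close>

lemma finite_independent_homog:
  assumes "S \<subseteq> vecs d" "B \<subseteq> homog d ` S" "fv.independent B"
  shows "finite B"
proof -
  define U :: "(nat \<Rightarrow> real) set" where "U = unit_fun ` {..d}"
  have "homog d x \<in> fv.span U" if "x \<in> vecs d" for x
    unfolding homog_eq_sum[OF that]
    by (intro fv.span_add fv.span_sum fv.span_scale fv.span_base) (auto simp: U_def)
  then have span: "homog d ` S \<subseteq> fv.span U" using assms by auto
  have "finite U" by (simp add: U_def)
  then show ?thesis
    using fv.independent_span_bound[of U B] span assms(2,3) by blast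
qed

lemma affdim_eq_dim_homog:
  assumes "S \<subseteq> vecs d" "S \<noteq> {}"
  shows "affdim S = int (fv.dim (homog d ` S)) - 1"
proof -
  obtain B where B: "B \<subseteq> homog d ` S" "fv.independent B" "homog d ` S \<subseteq> fv.span B"
    "card B = fv.dim (homog d ` S)"
    using fv.basis_exists by blast
  have "finite B" using finite_independent_homog assms(1) B(1,2) by blast
  \<comment> \<open>Homogenized points have coordinate \<open>d\<close> equal to 1, so the empty set
    cannot span them, and \<open>card B - 1\<close> is not truncated.\<close>
  moreover have "B \<noteq> {}"
  proof
    assume "B = {}"
    then obtain x where "homog d x = 0" using B(3) assms(2) by auto
    then have "homog d x d = 0" by simp
    then show False by (simp add: homog_def)
  qed
  ultimately have card: "card B > 0" by (simp add: card_gt_0_iff)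
  have "(GREATEST m. \<exists>P. P \<subseteq> S \<and> aff_indep P \<and> card P = Suc m) = card B - 1"
  proof (rule Greatest_equality)
    obtain P where P: "P \<subseteq> S" "B = homog d ` P" using B(1) by (auto simp: subset_image_iff)
    have inj: "inj_on (homog d) P" using inj_on_homog assms(1) P(1) by (meson inj_on_subset)
    have "finite P" using \<open>finite B\<close> inj P(2) by (simp add: finite_image_iff)
    moreover have "card P = card B" unfolding P(2) using inj by (simp add: card_image)
    moreover have "aff_indep P"
      using aff_indep_iff_independent_homog[of P d] P assms(1) B(2) calculation by auto
    ultimately show "\<exists>P. P \<subseteq> S \<and> aff_indep P \<and> card P = Suc (card B - 1)"
      using P(1) card by auto
  next
    fix m assume "\<exists>P. P \<subseteq> S \<and> aff_indep P \<and> card P = Suc m"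
    then obtain P where P: "P \<subseteq> S" "aff_indep P" "card P = Suc m" by blast
    have Pv: "P \<subseteq> vecs d" using P assms by auto
    have inj: "inj_on (homog d) P" using inj_on_homog Pv by (rule inj_on_subset)
    have "fv.independent (homog d ` P)" using aff_indep_iff_independent_homog[OF Pv] P by auto
    moreover have "homog d ` P \<subseteq> fv.span B" using B(3) P(1) by blast
    ultimately have "card (homog d ` P) \<le> card B"
      using fv.independent_span_bound[OF \<open>finite B\<close>] by blast
    then show "m \<le> card B - 1" using P(3) inj by (simp add: card_image)
  qed
  then show "affdim S = int (fv.dim (homog d ` S)) - 1"
    unfolding affdim_def using assms(2) B(4) card by simp
qed

text \<open>Some linear functional is 0 on a basis for the homogenized \<open>T\<close> and 1 at
  \<open>homog d z\<close>. On homogenized points it is affine, its constant term being its value at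
  \<open>unit_fun d\<close>.\<close>

lemma affine_separation:
  assumes "T \<subseteq> vecs d" "z \<in> vecs d" "homog d z \<notin> fv.span (homog d ` T)"
  obtains c \<gamma> where "\<And>x. x \<in> T \<Longrightarrow> (\<Sum>i<d. c i * x i) = \<gamma>" "(\<Sum>i<d. c i * z i) > \<gamma>"
proof -
  interpret fvr: vector_space_pair fscale "(*) :: real \<Rightarrow> real \<Rightarrow> real"
    by unfold_locales (auto simp: algebra_simps)
  obtain B where B: "B \<subseteq> homog d ` T" "fv.independent B" "homog d ` T \<subseteq> fv.span B"
    using fv.maximal_independent_subset by blast
  have z: "homog d z \<notin> fv.span B"
    using assms(3) fv.span_mono[OF B(1)] by blast
  then have "fv.independent (insert (homog d z) B)"
    using B(2) by (simp add: fv.independent_insertI)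
  then obtain g where g: "Vector_Spaces.linear fscale (*) g"
    "\<And>v. v \<in> insert (homog d z) B \<Longrightarrow> g v = (if v = homog d z then 1 else 0)"
    using fvr.linear_independent_extend[of _ "\<lambda>v. if v = homog d z then 1 else 0"] by blast
  interpret g: Vector_Spaces.linear fscale "(*)" g by (rule g)
  have B0: "g v = 0" if "v \<in> B" for v
    using g(2)[of v] that z fv.span_base by auto
  have "g v = 0" if "v \<in> fv.span B" for v
    using B0 that by (rule g.eq_0_on_span)
  then have T: "g (homog d x) = 0" if "x \<in> T" for x using B(3) that by blast
  have eq: "g (homog d x) = (\<Sum>i<d. g (unit_fun i) * x i) + g (unit_fun d)" if "x \<in> vecs d" for x
    unfolding homog_eq_sum[OF that] by (simp add: g.add g.sum g.scale mult.commute)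
  show ?thesis
  proof (rule that[of "\<lambda>i. g (unit_fun i)" "- g (unit_fun d)"])
    show "(\<Sum>i<d. g (unit_fun i) * x i) = - g (unit_fun d)" if "x \<in> T" for x
      using eq[of x] T[OF that] assms(1) that by auto
    show "- g (unit_fun d) < (\<Sum>i<d. g (unit_fun i) * z i)"
      using eq[OF assms(2)] g(2)[of "homog d z"] by simp
  qed
qed

text \<open>The affine function that vanishes on \<open>F\<close> becomes a linear functional on
  homogenized points; its kernel contains their span but not \<open>homog d y\<close>.\<close>

lemma homog_notin_span_face:
  assumes "\<And>x. x \<in> F \<Longrightarrow> (\<Sum>i<d. a i * x i) = b" "(\<Sum>i<d. a i * y i) \<noteq> b"
  shows "homog d y \<notin> fv.span (homog d ` F)"
proof
  define h where "h v = (\<Sum>i<d. a i * v i) - b * v d" for v :: "nat \<Rightarrow> real"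
  have hh: "h (homog d x) = (\<Sum>i<d. a i * x i) - b" for x by (simp add: h_def homog_def)
  assume y: "homog d y \<in> fv.span (homog d ` F)"
  have "h 0 = 0" "h (v + w) = h v + h w" "h (fscale c v) = c * h v" for c v w
    by (simp_all add: h_def algebra_simps sum.distrib sum_distrib_left)
  then have "fv.subspace {v. h v = 0}" by (intro fv.subspaceI) simp_all
  moreover have "homog d ` F \<subseteq> {v. h v = 0}" using hh assms(1) by auto
  ultimately have "h (homog d y) = 0" using y fv.span_minimal by blast
  then show False using hh assms(2) by simp
qed

subsection \<open>Faces as intersections of facets\<close>

text \<open>A face containing \<open>G\<close>, avoiding \<open>y\<close> and maximal with these properties is a facet: otherwise some
  linear functional is constant on the face and \<open>y\<close> but not on the polytope, and tilting the
  supporting hyperplane along it produces a larger such face.\<close>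

lemma face_enlarge:
  assumes X: "finite X" and F: "face_in d F (cvx_hull X)"
    and y: "y \<in> cvx_hull X" "y \<notin> F" and z: "z \<in> cvx_hull X"
    and c: "\<And>x. x \<in> insert y F \<Longrightarrow> (\<Sum>i<d. c i * x i) = \<gamma>" "(\<Sum>i<d. c i * z i) > \<gamma>"
  obtains F' where "face_in d F' (cvx_hull X)" "F \<subset> F'" "y \<notin> F'"
proof -
  obtain a b where ab: "\<And>x. x \<in> cvx_hull X \<Longrightarrow> (\<Sum>i<d. a i * x i) \<le> b"
    and Feq: "F = {x \<in> cvx_hull X. (\<Sum>i<d. a i * x i) = b}"
    using F unfolding face_in_def by blast
  define h where "h x = (\<Sum>i<d. a i * x i)" for x
  define g where "g x = (\<Sum>i<d. c i * x i) - \<gamma>" for x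
  define X' where "X' = {p \<in> X. g p > 0}"
  have "X' \<noteq> {}"
  proof
    assume "X' = {}"
    then have "\<And>p. p \<in> X \<Longrightarrow> (\<Sum>i<d. c i * p i) \<le> \<gamma>" by (auto simp: X'_def g_def not_less)
    then have "(\<Sum>i<d. c i * z i) \<le> \<gamma>" using cvx_hull_le[OF z] by blast
    then show False using c(2) by simp
  qed
  \<comment> \<open>\<open>r p\<close> is the tilt at which the generator \<open>p\<close> becomes
    tight. The smallest one, \<open>t\<close>, keeps all generators valid and adds its minimizer to
    the face.\<close>
  define r where "r p = (b - h p) / g p" for p
  define t where "t = Min (r ` X')"
  have fin: "finite X'" using X by (simp add: X'_def)
  then have "t \<in> r ` X'" unfolding t_def using \<open>X' \<noteq> {}\<close> by (intro Min_in) auto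
  then obtain p where p: "p \<in> X'" "t = r p" by blast
  have hX: "h q \<le> b" if "q \<in> X" for q
    using ab cvx_hull_superset[of X] that unfolding h_def by auto
  have t0: "t \<ge> 0" unfolding p(2) r_def using p(1) hX[of p] by (simp add: X'_def)
  define a' where "a' i = a i + t * c i" for i
  define b' where "b' = b + t * \<gamma>"
  have a': "(\<Sum>i<d. a' i * x i) = h x + t * g x + t * \<gamma>" for x
    by (simp add: a'_def h_def g_def algebra_simps sum.distrib sum_distrib_left)
  have valid: "(\<Sum>i<d. a' i * x i) \<le> b'" if "x \<in> cvx_hull X" for x
  proof (rule cvx_hull_le[OF that])
    fix q assume q: "q \<in> X"
    have "t * g q \<le> b - h q"
    proof (cases "g q > 0")
      case True
      then have "t \<le> r q" unfolding t_def using fin q by (intro Min_le) (auto simp: X'_def)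
      then show ?thesis using True by (simp add: r_def field_simps)
    next
      case False
      then have "t * g q \<le> 0" using t0 by (simp add: mult_nonneg_nonpos)
      then show ?thesis using hX[OF q] by simp
    qed
    then show "(\<Sum>i<d. a' i * q i) \<le> b'" unfolding a' b'_def by simp
  qed
  define F' where "F' = {x \<in> cvx_hull X. (\<Sum>i<d. a' i * x i) = b'}"
  show ?thesis
  proof (rule that)
    show "face_in d F' (cvx_hull X)" unfolding face_in_def F'_def using valid by blast
    have g0: "g x = 0" if "x \<in> insert y F" for x using c(1)[OF that] by (simp add: g_def)
    have "F \<subseteq> F'" unfolding F'_def a' b'_def using g0 unfolding Feq h_def by auto
    moreover have "p \<in> F'"
      using p cvx_hull_superset[of X] unfolding F'_def a' b'_def X'_def by (auto simp: r_def)
    moreover have "p \<notin> F" using p(1) g0[of p] by (auto simp: X'_def)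
    ultimately show "F \<subset> F'" by blast
    show "y \<notin> F'" using y g0[of y] unfolding F'_def a' b'_def Feq h_def by auto
  qed
qed

text \<open>Ranging over all \<open>y\<close> in \<open>Q\<close> outside \<open>G\<close>, this
  exhibits a nonempty face \<open>G\<close> as the intersection of \<open>Q\<close> with the facets
  containing it.\<close>

lemma exists_facet_avoiding:
  assumes Q: "polytope_in d Q" and G: "face_in d G Q" "G \<noteq> {}" and y: "y \<in> Q" "y \<notin> G"
  obtains F where "facet_in d F Q" "G \<subseteq> F" "y \<notin> F"
proof -
  obtain X where X: "finite X" "X \<subseteq> vecs d" "Q = cvx_hull X"
    using Q unfolding polytope_in_def by blast
  have Qv: "Q \<subseteq> vecs d" unfolding X(3) using cvx_hull_subset_vecs X(2) .
  define \<F> where "\<F> = {F. face_in d F Q \<and> G \<subseteq> F \<and> y \<notin> F}"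
  have "finite \<F>" using finite_faces[OF Q] unfolding \<F>_def by (rule rev_finite_subset) auto
  moreover have "\<F> \<noteq> {}" using G y by (auto simp: \<F>_def)
  ultimately obtain F where F: "F \<in> \<F>" "\<And>F'. F' \<in> \<F> \<Longrightarrow> F \<subseteq> F' \<Longrightarrow> F = F'"
    using finite_has_maximal[of \<F>] by auto
  have face: "face_in d F Q" and GF: "G \<subseteq> F" and yF: "y \<notin> F" using F(1) by (auto simp: \<F>_def)
  obtain a b where ab: "F = {x\<in>Q. (\<Sum>i<d. a i * x i) = b}" using face unfolding face_in_def by blast
  have FQ: "F \<subseteq> Q" using ab by auto
  have ySp: "homog d y \<notin> fv.span (homog d ` F)"
    by (rule homog_notin_span_face[where a = a and b = b]) (use ab y yF in auto)
  \<comment> \<open>Otherwise \<open>affine_separation\<close> and \<open>face_enlarge\<close>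
    produce a larger face that still avoids \<open>y\<close>.\<close>
  have span: "homog d z \<in> fv.span (homog d ` insert y F)" if z: "z \<in> Q" for z
  proof (rule ccontr)
    assume nsp: "homog d z \<notin> fv.span (homog d ` insert y F)"
    have "insert y F \<subseteq> vecs d" "z \<in> vecs d" using z Qv y FQ by auto
    then obtain c \<gamma> where "\<And>x. x \<in> insert y F \<Longrightarrow> (\<Sum>i<d. c i * x i) = \<gamma>" "(\<Sum>i<d. c i * z i) > \<gamma>"
      using affine_separation[OF _ _ nsp] by blast
    then obtain F' where "face_in d F' Q" "F \<subset> F'" "y \<notin> F'"
      using face_enlarge[OF X(1) face[unfolded X(3)] y(1)[unfolded X(3)] yF z[unfolded X(3)]]
      unfolding X(3) by blast
    then show False using F(2)[of F'] GF by (auto simp: \<F>_def)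
  qed
  have "F \<noteq> {}" "Q \<noteq> {}" using GF G(2) y by auto
  have FV: "F \<subseteq> vecs d" using FQ Qv by auto
  obtain B where B: "B \<subseteq> homog d ` F" "fv.independent B" "homog d ` F \<subseteq> fv.span B"
    "card B = fv.dim (homog d ` F)"
    using fv.basis_exists by blast
  have yB: "homog d y \<notin> fv.span B" using ySp fv.span_mono[OF B(1)] by blast
  \<comment> \<open>A basis for \<open>F\<close> extended by \<open>homog d y\<close> is one for
    \<open>Q\<close>, so the dimensions differ by exactly one.\<close>
  have "fv.dim (homog d ` Q) = card (insert (homog d y) B)"
  proof (rule fv.dim_unique)
    show "insert (homog d y) B \<subseteq> homog d ` Q" using B(1) FQ y by blast
    show "fv.independent (insert (homog d y) B)" using B(2) yB by (simp add: fv.independent_insertI)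
    have "homog d ` F \<subseteq> fv.span (insert (homog d y) B)"
      using B(3) fv.span_mono[of B "insert (homog d y) B"] by blast
    then have "homog d ` insert y F \<subseteq> fv.span (insert (homog d y) B)"
      by (auto intro: fv.span_base)
    then have "fv.span (homog d ` insert y F) \<subseteq> fv.span (insert (homog d y) B)"
      by (intro fv.span_minimal fv.subspace_span)
    then show "homog d ` Q \<subseteq> fv.span (insert (homog d y) B)" using span by blast
  qed simp
  also have "\<dots> = Suc (card B)"
  proof (rule card_insert_disjoint)
    show "finite B" using FV B(1,2) by (rule finite_independent_homog)
    show "homog d y \<notin> B" using yB fv.span_base by blast
  qed
  finally have "affdim F = affdim Q - 1"
    using affdim_eq_dim_homog[OF FV \<open>F \<noteq> {}\<close>] affdim_eq_dim_homog[OF Qv \<open>Q \<noteq> {}\<close>] B(4) by simp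
  then have "facet_in d F Q" unfolding facet_in_def using face \<open>F \<noteq> {}\<close> by blast
  then show ?thesis using that GF yF by blast
qed

subsection \<open>Extension complexity and rectangle coverings\<close>

lemma finite_facets:
  assumes "polytope_in d Q"
  shows "finite {F. facet_in d F Q}"
  using finite_faces[OF assms] by (rule rev_finite_subset) (auto simp: facet_in_def)

text \<open>Each facet of an extension yields a rectangle of non-incident inequality--point pairs: the
  inequalities whose face lies in the facet against the points lying off it.\<close>

lemma facets_cover_slack_support:
  fixes w :: "'a \<Rightarrow> 'e \<Rightarrow> real"
  assumes Q': "polytope_in d Q'" and Q: "Q = (\<lambda>x e. \<Sum>i<d. M e i * x i) ` Q'"
    and valid: "\<And>a x. a \<in> A \<Longrightarrow> x \<in> Q \<Longrightarrow> (\<Sum>e\<in>E. w a e * x e) \<le> \<delta> a"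
    and tight: "\<And>a. a \<in> A \<Longrightarrow> \<exists>x\<in>Q. (\<Sum>e\<in>E. w a e * x e) = \<delta> a"
    and pt: "\<And>b. b \<in> B \<Longrightarrow> pt b \<in> Q"
  obtains RA RB where "\<And>F. RA F \<subseteq> A" "\<And>F. RB F \<subseteq> B"
    "\<And>F a b. a \<in> RA F \<Longrightarrow> b \<in> RB F \<Longrightarrow> (\<Sum>e\<in>E. w a e * pt b e) \<noteq> \<delta> a"
    "\<And>a b. a \<in> A \<Longrightarrow> b \<in> B \<Longrightarrow> (\<Sum>e\<in>E. w a e * pt b e) \<noteq> \<delta> a \<Longrightarrow>
       \<exists>F. facet_in d F Q' \<and> a \<in> RA F \<and> b \<in> RB F"
proof -
  define \<pi> where "\<pi> x e = (\<Sum>i<d. M e i * x i)" for x e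
  have Q\<pi>: "Q = \<pi> ` Q'" unfolding Q \<pi>_def by simp
  \<comment> \<open>\<open>v a\<close> is the inequality \<open>w a\<close> pulled back along
    \<open>\<pi>\<close>; its tight set in \<open>Q'\<close> is the face \<open>G a\<close>.\<close>
  define v where "v a i = (\<Sum>e\<in>E. w a e * M e i)" for a i
  have pull: "(\<Sum>i<d. v a i * x i) = (\<Sum>e\<in>E. w a e * \<pi> x e)" for a x
    unfolding v_def \<pi>_def sum_distrib_left sum_distrib_right
    by (subst sum.swap) (simp add: mult.assoc)
  define G where "G a = {x\<in>Q'. (\<Sum>i<d. v a i * x i) = \<delta> a}" for a
  have face: "face_in d (G a) Q'" if "a \<in> A" for a
    unfolding face_in_def G_def using valid[OF that]
    by (intro exI[of _ "v a"] exI[of _ "\<delta> a"]) (auto simp: pull Q\<pi>)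
  have Gne: "G a \<noteq> {}" if "a \<in> A" for a
    using tight[OF that] unfolding G_def by (auto simp: pull Q\<pi>)
  \<comment> \<open>One arbitrary preimage per point suffices, as tightness depends only on the
    projection.\<close>
  have "\<forall>b\<in>B. \<exists>y. y \<in> Q' \<and> \<pi> y = pt b"
    using pt unfolding Q\<pi> image_iff by metis
  then obtain y where y: "\<And>b. b \<in> B \<Longrightarrow> y b \<in> Q' \<and> \<pi> (y b) = pt b"
    unfolding bchoice_iff by blast
  have yG: "y b \<in> G a \<longleftrightarrow> (\<Sum>e\<in>E. w a e * pt b e) = \<delta> a" if "b \<in> B" for a b
    using y[OF that] by (simp add: G_def pull)
  show ?thesis
  proof (rule that[of "\<lambda>F. {a \<in> A. G a \<subseteq> F}" "\<lambda>F. {b \<in> B. y b \<notin> F}"], goal_cases)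
    case (3 F a b)
    then show ?case using yG by blast
  next
    case (4 a b)
    then have "y b \<in> Q'" "y b \<notin> G a" using y yG by auto
    from exists_facet_avoiding[OF Q' face Gne this] 4 obtain F where
      "facet_in d F Q'" "G a \<subseteq> F" "y b \<notin> F" by blast
    then show ?case using 4(1,2) by blast
  qed auto
qed

text \<open>A simplex maps onto every finite hull, so the \<open>LEAST\<close> in \<open>xc\<close> ranges over a nonempty set.\<close>

lemma cvx_hull_is_extension_image:
  fixes X :: "('e \<Rightarrow> real) set"
  assumes "finite X"
  shows "\<exists>d Q' (M :: 'e \<Rightarrow> nat \<Rightarrow> real).
    polytope_in d Q' \<and> cvx_hull X = (\<lambda>x e. \<Sum>i<d. M e i * x i) ` Q'"
proof -
  obtain f where f: "bij_betw f {..<card X} X"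
    using ex_bij_betw_nat_finite[OF assms] by (auto simp: atLeast0LessThan)
  define d where "d = card X"
  have inj_unit: "inj unit_fun" by (rule injI) (metis unit_fun_def zero_neq_one)
  define Q' where "Q' = cvx_hull (unit_fun ` {..<d})"
  have "polytope_in d Q'" unfolding polytope_in_def Q'_def
    by (intro exI[of _ "unit_fun ` {..<d}"]) (auto simp: vecs_def unit_fun_def)
  define Lam where "Lam = {l :: nat \<Rightarrow> real. (\<forall>i<d. l i \<ge> 0) \<and> (\<Sum>i<d. l i) = 1}"
  \<comment> \<open>Barycentric coordinates: used for \<open>f\<close> and for
    \<open>unit_fun\<close>, this makes both hulls images of the same \<open>Lam\<close>.\<close>
  have hull: "cvx_hull (h ` {..<d}) = (\<lambda>l j. \<Sum>i<d. l i * h i j) ` Lam"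
    if inj: "inj_on h {..<d}" for h :: "nat \<Rightarrow> 'c \<Rightarrow> real"
  proof (intro subset_antisym subsetI)
    fix y assume "y \<in> cvx_hull (h ` {..<d})"
    then obtain l where "\<forall>p\<in>h ` {..<d}. l p \<ge> 0" "sum l (h ` {..<d}) = 1"
      "y = (\<lambda>j. \<Sum>p\<in>h ` {..<d}. l p * p j)"
      by (auto simp: cvx_hull_finite)
    then show "y \<in> (\<lambda>l j. \<Sum>i<d. l i * h i j) ` Lam"
      by (intro image_eqI[of _ _ "\<lambda>i. l (h i)"]) (auto simp: Lam_def sum.reindex[OF inj])
  next
    fix y assume "y \<in> (\<lambda>l j. \<Sum>i<d. l i * h i j) ` Lam"
    then obtain l where "l \<in> Lam" "y = (\<lambda>j. \<Sum>i<d. l i * h i j)" by blast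
    then show "y \<in> cvx_hull (h ` {..<d})"
      using the_inv_into_f_f[OF inj]
      by (simp add: cvx_hull_finite)
        (intro exI[of _ "\<lambda>p. l (the_inv_into {..<d} h p)"], auto simp: Lam_def sum.reindex[OF inj])
  qed
  have coord: "(\<Sum>i<d. f i e * (\<Sum>k<d. l k * unit_fun k i)) = (\<Sum>i<d. l i * f i e)" for l e
    by (intro sum.cong refl) (simp add: unit_fun_def if_distrib[of "\<lambda>x. _ * x"] mult.commute cong: if_cong)
  have "cvx_hull X = cvx_hull (f ` {..<d})" using f unfolding bij_betw_def d_def by simp
  also have "\<dots> = (\<lambda>l j. \<Sum>i<d. l i * f i j) ` Lam"
    using f unfolding bij_betw_def d_def by (intro hull[unfolded d_def]) auto
  also have "\<dots> = (\<lambda>x e. \<Sum>i<d. f i e * x i) ` Q'"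
    unfolding Q'_def hull[OF inj_on_subset[OF inj_unit subset_UNIV]] image_image coord ..
  finally show ?thesis using \<open>polytope_in d Q'\<close> by (intro exI[of _ d] exI[of _ Q'] exI[of _ "\<lambda>e i. f i e"]) simp
qed

lemma xc_attained:
  fixes X :: "('e \<Rightarrow> real) set"
  assumes "finite X"
  obtains d Q' and M :: "'e \<Rightarrow> nat \<Rightarrow> real" where "polytope_in d Q'"
    "cvx_hull X = (\<lambda>x e. \<Sum>i<d. M e i * x i) ` Q'" "card {F. facet_in d F Q'} = xc (cvx_hull X)"
proof -
  have "\<exists>k d Q' (M :: 'e \<Rightarrow> nat \<Rightarrow> real). polytope_in d Q' \<and>
      cvx_hull X = (\<lambda>x e. \<Sum>i<d. M e i * x i) ` Q' \<and> card {F. facet_in d F Q'} = k"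
    using cvx_hull_is_extension_image[OF assms] by blast
  from LeastI_ex[OF this] show ?thesis unfolding xc_def[symmetric] using that by blast
qed

subsection \<open>The rectangle bound for unique disjointness\<close>

definition disjoint_pairs :: "'a set set \<Rightarrow> 'a set set \<Rightarrow> ('a set \<times> 'a set) set" where
  "disjoint_pairs A B = {(a, b). a \<in> A \<and> b \<in> B \<and> a \<inter> b = {}}"

text \<open>In a disjoint pair, \<open>x\<close> lies in neither set, only in the left one or only
  in the right one; deleting it gives the three summands.\<close>

lemma card_disjoint_pairs_split:
  assumes "finite N" "x \<notin> N" "A \<subseteq> Pow (insert x N)" "B \<subseteq> Pow (insert x N)"
  defines "A0 \<equiv> {a \<in> Pow N. a \<in> A}" and "A1 \<equiv> {a \<in> Pow N. insert x a \<in> A}"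
    and "B0 \<equiv> {b \<in> Pow N. b \<in> B}" and "B1 \<equiv> {b \<in> Pow N. insert x b \<in> B}"
  shows "card (disjoint_pairs A B) =
    card (disjoint_pairs A0 B0) + card (disjoint_pairs A1 B0) + card (disjoint_pairs A0 B1)"
proof -
  define f where "f = (\<lambda>(a, b::'a set). (insert x a, b))"
  define g where "g = (\<lambda>(a::'a set, b). (a, insert x b))"
  have fin: "finite (disjoint_pairs C D)" if "C \<subseteq> Pow N" "D \<subseteq> Pow N" for C D
    by (rule finite_subset[of _ "Pow N \<times> Pow N"]) (use that assms(1) in \<open>auto simp: disjoint_pairs_def\<close>)
  have sub: "A0 \<subseteq> Pow N" "A1 \<subseteq> Pow N" "B0 \<subseteq> Pow N" "B1 \<subseteq> Pow N"
    by (auto simp: A0_def A1_def B0_def B1_def)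
  have ins: "insert x a = insert x a' \<longleftrightarrow> a = a'" if "a \<in> A1 \<and> a' \<in> A1 \<or> a \<in> B1 \<and> a' \<in> B1" for a a'
    using that sub assms(2) by (metis PowD insert_ident subsetD)
  have injf: "inj_on f (disjoint_pairs A1 B0)"
    by (rule inj_onI) (auto simp: f_def disjoint_pairs_def ins)
  have injg: "inj_on g (disjoint_pairs A0 B1)"
    by (rule inj_onI) (auto simp: g_def disjoint_pairs_def ins)
  have eq: "disjoint_pairs A B =
      disjoint_pairs A0 B0 \<union> f ` disjoint_pairs A1 B0 \<union> g ` disjoint_pairs A0 B1" (is "_ = ?R")
  proof (intro subset_antisym subsetI)
    fix p assume "p \<in> disjoint_pairs A B"
    then obtain a b where ab: "p = (a, b)" "a \<in> A" "b \<in> B" "a \<inter> b = {}"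
      by (auto simp: disjoint_pairs_def)
    then have s: "a - {x} \<subseteq> N" "b - {x} \<subseteq> N" using assms(3,4) by auto
    consider "x \<notin> a" "x \<notin> b" | "x \<in> a" "x \<notin> b" | "x \<notin> a" "x \<in> b" using ab(4) by blast
    then show "p \<in> ?R"
    proof cases
      case 1
      then have "p \<in> disjoint_pairs A0 B0"
        using ab s by (auto simp: disjoint_pairs_def A0_def B0_def)
      then show ?thesis by blast
    next
      case 2
      then have "(a - {x}, b) \<in> disjoint_pairs A1 B0" "p = f (a - {x}, b)"
        using ab s by (auto simp: disjoint_pairs_def A1_def B0_def f_def insert_absorb)
      then show ?thesis by blast
    next
      case 3
      then have "(a, b - {x}) \<in> disjoint_pairs A0 B1" "p = g (a, b - {x})"
        using ab s by (auto simp: disjoint_pairs_def A0_def B1_def g_def insert_absorb)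
      then show ?thesis by blast
    qed
  next
    fix p assume "p \<in> ?R"
    then show "p \<in> disjoint_pairs A B"
      using assms(2) by (auto simp: disjoint_pairs_def A0_def A1_def B0_def B1_def f_def g_def)
  qed
  have d1: "disjoint_pairs A0 B0 \<inter> f ` disjoint_pairs A1 B0 = {}"
    using sub assms(2) by (auto simp: disjoint_pairs_def f_def)
  have d2: "(disjoint_pairs A0 B0 \<union> f ` disjoint_pairs A1 B0) \<inter> g ` disjoint_pairs A0 B1 = {}"
    using sub assms(2) by (auto simp: disjoint_pairs_def f_def g_def)
  show ?thesis
    unfolding eq using fin sub d1 d2
    by (simp add: card_Un_disjoint card_image[OF injf] card_image[OF injg])
qed

lemma card_disjoint_pairs_Pow:
  assumes "finite N"
  shows "card (disjoint_pairs (Pow N) (Pow N)) = 3 ^ card N"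
  using assms
proof (induction N)
  case empty
  have "disjoint_pairs (Pow {}) (Pow {}) = {({} :: 'a set, {} :: 'a set)}"
    by (auto simp: disjoint_pairs_def)
  then show ?case by simp
next
  case (insert x N)
  have "{a \<in> Pow N. a \<in> Pow (insert x N)} = Pow N" "{a \<in> Pow N. insert x a \<in> Pow (insert x N)} = Pow N"
    by auto
  then show ?case
    using card_disjoint_pairs_split[OF insert(1,2) subset_refl subset_refl] insert by simp
qed

text \<open>Kaibel and Weltge: after removing one element \<open>x\<close>, the disjoint pairs of the rectangle
  \<open>A \<times> B\<close> are covered with multiplicity by those of the rectangles \<open>(A0 \<union> A1) \<times> B0\<close> and \<open>A0 \<times> (B0 \<union> B1)\<close>;
  no disjoint pair lies in \<open>A1 \<times> B1\<close>, since adding \<open>x\<close> to both sides would give intersection size 1.\<close>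

lemma card_disjoint_pairs_le:
  assumes "finite N" "A \<subseteq> Pow N" "B \<subseteq> Pow N" "\<And>a b. a \<in> A \<Longrightarrow> b \<in> B \<Longrightarrow> card (a \<inter> b) \<noteq> 1"
  shows "card (disjoint_pairs A B) \<le> 2 ^ card N"
  using assms
proof (induction N arbitrary: A B)
  case empty
  have "disjoint_pairs A B \<subseteq> {({}, {})}" using empty by (auto simp: disjoint_pairs_def)
  then have "card (disjoint_pairs A B) \<le> card {({} :: 'a set, {} :: 'a set)}" by (intro card_mono) auto
  then show ?case by simp
next
  case (insert x N)
  define A0 A1 B0 B1 where defs: "A0 = {a \<in> Pow N. a \<in> A}" "A1 = {a \<in> Pow N. insert x a \<in> A}"
    "B0 = {b \<in> Pow N. b \<in> B}" "B1 = {b \<in> Pow N. insert x b \<in> B}"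
  have x: "a \<inter> insert x b = a \<inter> b" "insert x a \<inter> b = a \<inter> b" if "a \<subseteq> N" "b \<subseteq> N" for a b
    using insert(2) that by auto
  have ne1: "card (a \<inter> b) \<noteq> 1" if "a \<in> A0 \<and> b \<in> B0 \<or> a \<in> A1 \<and> b \<in> B0 \<or> a \<in> A0 \<and> b \<in> B1" for a b
    using that x[of a b] insert.prems(3)[of a b] insert.prems(3)[of "insert x a" b]
      insert.prems(3)[of a "insert x b"] by (auto simp: defs)
  have ne0: "a \<inter> b \<noteq> {}" if "a \<in> A1" "b \<in> B1" for a b
  proof
    assume "a \<inter> b = {}"
    then have eq: "insert x a \<inter> insert x b = {x}" by blast
    have "card (insert x a \<inter> insert x b) = 1" unfolding eq by simp
    then show False using insert.prems(3)[of "insert x a" "insert x b"] that unfolding defs by blast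
  qed
  have sub: "A0 \<subseteq> Pow N" "A1 \<subseteq> Pow N" "B0 \<subseteq> Pow N" "B1 \<subseteq> Pow N" by (auto simp: defs)
  have fin: "finite (disjoint_pairs C D)" if "C \<subseteq> Pow N" "D \<subseteq> Pow N" for C D
    by (rule finite_subset[of _ "Pow N \<times> Pow N"]) (use that insert(1) in \<open>auto simp: disjoint_pairs_def\<close>)
  let ?P = "disjoint_pairs A0 B0" and ?Q = "disjoint_pairs A1 B0" and ?R = "disjoint_pairs A0 B1"
  have disj: "(?P \<inter> ?Q) \<inter> ?R = {}" using ne0 by (auto simp: disjoint_pairs_def)
  have "card (disjoint_pairs A B) = card ?P + card ?Q + card ?R"
    unfolding defs by (rule card_disjoint_pairs_split) (use insert in auto)
  \<comment> \<open>Pairs in both \<open>?P\<close> and \<open>?Q\<close> count twice; the second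
    copy is grouped with \<open>?R\<close>, from which it is disjoint, inside the second
    rectangle.\<close>
  also have "card ?P + card ?Q = card (?P \<union> ?Q) + card (?P \<inter> ?Q)"
    by (rule card_Un_Int) (use fin sub in auto)
  also have "card (?P \<union> ?Q) + card (?P \<inter> ?Q) + card ?R = card (?P \<union> ?Q) + card ((?P \<inter> ?Q) \<union> ?R)"
    using fin sub disj by (simp add: card_Un_disjoint)
  also have "?P \<union> ?Q = disjoint_pairs (A0 \<union> A1) B0" by (auto simp: disjoint_pairs_def)
  also have "card ((?P \<inter> ?Q) \<union> ?R) \<le> card (disjoint_pairs A0 (B0 \<union> B1))"
    using sub by (intro card_mono fin) (auto simp: disjoint_pairs_def)
  also have "card (disjoint_pairs (A0 \<union> A1) B0) \<le> 2 ^ card N"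
    using sub ne1 by (intro insert.IH) auto
  also have "card (disjoint_pairs A0 (B0 \<union> B1)) \<le> 2 ^ card N"
    using sub ne1 by (intro insert.IH) auto
  finally show ?case using insert by simp
qed

text \<open>The cover need not reach the pairs with \<open>a = {}\<close>. There are
  \<open>2 ^ card N\<close> of them, as many as one rectangle may contain, hence the
  \<open>+ 1\<close>.\<close>

lemma unique_disjointness_cover_bound:
  fixes N :: "'a set"
  assumes "finite N" "finite I" "\<And>i. i \<in> I \<Longrightarrow> RA i \<subseteq> Pow N \<and> RB i \<subseteq> Pow N"
    and rect: "\<And>i a b. i \<in> I \<Longrightarrow> a \<in> RA i \<Longrightarrow> b \<in> RB i \<Longrightarrow> card (a \<inter> b) \<noteq> 1"
    and cover: "\<And>a b. a \<subseteq> N \<Longrightarrow> b \<subseteq> N \<Longrightarrow> a \<noteq> {} \<Longrightarrow> a \<inter> b = {} \<Longrightarrow> \<exists>i\<in>I. a \<in> RA i \<and> b \<in> RB i"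
  shows "3 ^ card N \<le> (card I + 1) * 2 ^ card N"
proof -
  have fin: "finite (disjoint_pairs (RA i) (RB i))" if "i \<in> I" for i
    by (rule finite_subset[of _ "Pow N \<times> Pow N"])
      (use assms(1) assms(3)[OF that] in \<open>auto simp: disjoint_pairs_def\<close>)
  have "disjoint_pairs (Pow N) (Pow N) \<subseteq> (\<Union>i\<in>I. disjoint_pairs (RA i) (RB i)) \<union> {{}} \<times> Pow N"
  proof
    fix p assume "p \<in> disjoint_pairs (Pow N) (Pow N)"
    then obtain a b where ab: "p = (a, b)" "a \<subseteq> N" "b \<subseteq> N" "a \<inter> b = {}"
      by (auto simp: disjoint_pairs_def)
    show "p \<in> (\<Union>i\<in>I. disjoint_pairs (RA i) (RB i)) \<union> {{}} \<times> Pow N"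
    proof (cases "a = {}")
      case False
      then obtain i where "i \<in> I" "a \<in> RA i" "b \<in> RB i" using cover[of a b] ab by blast
      then show ?thesis using ab(1,4) by (auto simp: disjoint_pairs_def)
    qed (use ab in auto)
  qed
  then have "3 ^ card N \<le> card ((\<Union>i\<in>I. disjoint_pairs (RA i) (RB i)) \<union> {{}} \<times> Pow N)"
    unfolding card_disjoint_pairs_Pow[OF assms(1), symmetric]
    using assms(1,2) fin by (intro card_mono) auto
  also have "\<dots> \<le> (\<Sum>i\<in>I. card (disjoint_pairs (RA i) (RB i))) + card ({{} :: 'a set} \<times> Pow N)"
    by (intro order_trans[OF card_Un_le] add_right_mono card_UN_le assms(2))
  also have "\<dots> \<le> (\<Sum>i\<in>I. 2 ^ card N) + 2 ^ card N"
    using assms(1,3) rect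
    by (intro add_mono sum_mono card_disjoint_pairs_le) (auto simp: card_cartesian_product card_Pow)
  finally show ?thesis by simp
qed

subsection \<open>The bipartite graph\<close>

text \<open>Conflict graph: a complete graph on the diagonal pairs \<open>(i, i)\<close> with every edge replaced by the path
  \<open>(i, i), (i, j), (j, i), (j, j)\<close>. Its vertices become the edges \<open>gedge p p\<close> of a bipartite graph, and
  two such edges are joined by an edge exactly if they are in conflict; hence stable sets of the
  conflict graph correspond to induced matchings consisting of diagonal edges.\<close>

definition gedge :: "nat \<times> nat \<Rightarrow> nat \<times> nat \<Rightarrow> nat set" where
  "gedge p q = {2 * prod_encode p, 2 * prod_encode q + 1}"

text \<open>The three cases give the diagonal edges, the middle edges of the paths and their outer
  edges. An outer edge is taken in one orientation only, which already creates the conflict.\<close>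

definition link :: "nat \<times> nat \<Rightarrow> nat \<times> nat \<Rightarrow> bool" where
  "link p q \<longleftrightarrow> q = p \<or> q = prod.swap p \<or> fst p = snd p \<and> fst q = fst p"

definition gverts :: "nat \<Rightarrow> nat set" where
  "gverts k = (\<lambda>p. 2 * prod_encode p) ` ({..<k} \<times> {..<k}) \<union> (\<lambda>p. 2 * prod_encode p + 1) ` ({..<k} \<times> {..<k})"

definition gedges :: "nat \<Rightarrow> nat set set" where
  "gedges k = {gedge p q | p q. p \<in> {..<k} \<times> {..<k} \<and> q \<in> {..<k} \<times> {..<k} \<and> link p q}"

lemma double_neq_Suc_double: "2 * m \<noteq> Suc (2 * n)" "Suc (2 * n) \<noteq> 2 * m" for m n :: nat
  by presburger+

lemma gedge_eq_iff: "gedge p q = gedge p' q' \<longleftrightarrow> p = p' \<and> q = q'"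
  by (auto simp: gedge_def doubleton_eq_iff double_neq_Suc_double)

lemma gedge_Int: "gedge p q \<inter> gedge p' q' = {} \<longleftrightarrow> p \<noteq> p' \<and> q \<noteq> q'"
  by (auto simp: gedge_def double_neq_Suc_double)

lemma inj_gedge_diag: "inj_on (\<lambda>p. gedge p p) S"
  by (auto simp: inj_on_def gedge_eq_iff)

lemma simple_graph_gverts_gedges: "simple_graph (gverts k) (gedges k)"
  unfolding simple_graph_def
proof (intro conjI ballI)
  fix e assume "e \<in> gedges k"
  then obtain p q where "p \<in> {..<k} \<times> {..<k}" "q \<in> {..<k} \<times> {..<k}" "e = gedge p q"
    unfolding gedges_def by blast
  then have "2 * prod_encode p \<in> gverts k" "2 * prod_encode q + 1 \<in> gverts k"
    "2 * prod_encode p \<noteq> 2 * prod_encode q + 1" "e = {2 * prod_encode p, 2 * prod_encode q + 1}"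
    unfolding gverts_def gedge_def using double_neq_Suc_double by auto
  then show "\<exists>u v. u \<in> gverts k \<and> v \<in> gverts k \<and> u \<noteq> v \<and> e = {u, v}" by blast
qed (simp add: gverts_def)

lemma bipartite_gverts_gedges: "bipartite (gverts k) (gedges k)"
  unfolding bipartite_def
proof (intro exI conjI ballI)
  let ?A = "(\<lambda>p. 2 * prod_encode p) ` ({..<k} \<times> {..<k})"
  show "?A \<subseteq> gverts k" by (simp add: gverts_def)
  fix e assume "e \<in> gedges k"
  then obtain p q where "p \<in> {..<k} \<times> {..<k}" "e = gedge p q" by (auto simp: gedges_def)
  then have "e \<inter> ?A = {2 * prod_encode p}" by (auto simp: gedge_def double_neq_Suc_double)
  then show "card (e \<inter> ?A) = 1" by simp
qed

lemma card_gverts: "card (gverts k) \<le> 2 * (k * k)"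
proof -
  have "card (f ` ({..<k} \<times> {..<k})) \<le> k * k" for f :: "nat \<times> nat \<Rightarrow> nat"
    using card_image_le[of "{..<k} \<times> {..<k}" f] by simp
  then show ?thesis
    unfolding gverts_def mult_2 by (intro order_trans[OF card_Un_le] add_mono)
qed

text \<open>Each case of \<open>link\<close> leaves only one pair free (\<open>q\<close> in the last
  case), so the number of edges is quadratic in \<open>k\<close>.\<close>

lemma gedges_subset:
  "gedges k \<subseteq> (\<lambda>p. gedge p p) ` ({..<k} \<times> {..<k}) \<union> (\<lambda>p. gedge p (prod.swap p)) ` ({..<k} \<times> {..<k}) \<union>
     (\<lambda>p. gedge (fst p, fst p) p) ` ({..<k} \<times> {..<k})"
proof
  fix e assume "e \<in> gedges k"
  then obtain p q where pq: "p \<in> {..<k} \<times> {..<k}" "q \<in> {..<k} \<times> {..<k}" "link p q" "e = gedge p q"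
    by (auto simp: gedges_def)
  then have "q = p \<or> q = prod.swap p \<or> p = (fst q, fst q)"
    unfolding link_def by (metis prod.collapse)
  then show "e \<in> (\<lambda>p. gedge p p) ` ({..<k} \<times> {..<k}) \<union> (\<lambda>p. gedge p (prod.swap p)) ` ({..<k} \<times> {..<k}) \<union>
     (\<lambda>p. gedge (fst p, fst p) p) ` ({..<k} \<times> {..<k})"
    using pq(1,2,4) by blast
qed

lemma finite_gedges: "finite (gedges k)"
  by (rule finite_subset[OF gedges_subset]) auto

lemma card_gedges: "card (gedges k) \<le> 3 * (k * k)"
proof -
  have *: "card (f ` ({..<k} \<times> {..<k})) \<le> k * k" for f :: "nat \<times> nat \<Rightarrow> nat set"
    using card_image_le[of "{..<k} \<times> {..<k}" f] by simp
  have "card (gedges k) \<le> (k * k + k * k) + k * k"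
    by (rule order_trans[OF card_mono[OF _ gedges_subset]])
      (auto intro!: order_trans[OF card_Un_le] add_mono *)
  then show ?thesis by simp
qed

subsection \<open>Valid inequalities and the matchings they separate\<close>

text \<open>Pairs are grouped with their swaps because the estimates below bound
  \<open>s (i, j) + s (j, i)\<close> jointly.\<close>

lemma sum_square_symmetrize:
  fixes s :: "nat \<times> nat \<Rightarrow> real"
  shows "2 * sum s (a \<times> a) = (\<Sum>i\<in>a. \<Sum>j\<in>a. s (i, j) + s (j, i))"
proof -
  have "(\<Sum>i\<in>a. \<Sum>j\<in>a. s (j, i)) = (\<Sum>i\<in>a. \<Sum>j\<in>a. s (i, j))" by (rule sum.swap)
  then show ?thesis by (simp add: sum.distrib sum.cartesian_product)
qed

text \<open>For \<open>t i\<close> in \<open>{0, 1}\<close> the diagonal correction turns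
  \<open>1 - t i * t i\<close> into \<open>2 * t i\<close>, the joint value of \<open>(i, i)\<close>
  with itself.\<close>

lemma sum_square_profile:
  fixes t :: "nat \<Rightarrow> real"
  assumes "finite a"
  shows "(\<Sum>i\<in>a. \<Sum>j\<in>a. 1 - t i * t j + (if i = j then 3 * t i - 1 else 0)) =
    real (card a) ^ 2 - real (card a) + 2 - (sum t a - 1) * (sum t a - 2)"
proof -
  have "(\<Sum>i\<in>a. \<Sum>j\<in>a. t i * t j) = sum t a * sum t a" by (simp add: sum_product)
  moreover have "(\<Sum>i\<in>a. \<Sum>j\<in>a. if i = j then 3 * t i - 1 else 0) = 3 * sum t a - real (card a)"
    using assms by (simp add: sum.delta' sum_subtractf sum_distrib_left)
  ultimately show ?thesis
    by (simp add: sum.distrib sum_subtractf power2_eq_square algebra_simps)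
qed

lemma induced_matching_diagD:
  assumes M: "induced_matching (gedges k) M" and "p \<in> {..<k} \<times> {..<k}" "q \<in> {..<k} \<times> {..<k}"
    "p \<noteq> q" "link p q"
  shows "incidence M (gedge p p) + incidence M (gedge q q) \<le> 1"
proof (rule ccontr)
  assume "\<not> ?thesis"
  then have "gedge p p \<in> M" "gedge q q \<in> M" by (auto simp: incidence_def split: if_splits)
  moreover have "gedge p q \<in> gedges k" using assms by (auto simp: gedges_def)
  moreover have "gedge p q \<inter> gedge p p \<noteq> {}" "gedge p q \<inter> gedge q q \<noteq> {}"
    "gedge p p \<noteq> gedge q q" using assms(4) by (simp_all add: gedge_Int gedge_eq_iff)
  ultimately show False using M unfolding induced_matching_def by blast
qed

text \<open>With \<open>T\<close> the number of \<open>i \<in> a\<close> whose edge \<open>(i, i)\<close> is chosen, the slack is at least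
  \<open>(T - 1) * (T - 2) / 2\<close>.\<close>

lemma induced_matching_square_le:
  assumes M: "induced_matching (gedges k) M" and a: "a \<subseteq> {..<k}"
  shows "(\<Sum>p\<in>a \<times> a. incidence M (gedge p p)) \<le> (real (card a) ^ 2 - real (card a) + 2) / 2"
proof -
  have fin: "finite a" using a finite_subset by blast
  define s where "s p = incidence M (gedge p p)" for p
  define t where "t i = s (i, i)" for i
  have s01: "s p = 0 \<or> s p = 1" for p by (simp add: s_def incidence_def)
  have bound: "s (i, j) + s (j, i) \<le> 1 - t i * t j + (if i = j then 3 * t i - 1 else 0)"
    if "i \<in> a" "j \<in> a" for i j
  proof (cases "i = j")
    case True
    then show ?thesis using s01[of "(i, i)"] by (auto simp: t_def)
  next
    case False
    \<comment> \<open>One constraint per edge of the path from \<open>(i, i)\<close> to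
      \<open>(j, j)\<close>: if both ends are chosen, neither inner vertex is.\<close>
    have "s (i, j) + s (j, i) \<le> 1" "t i + s (i, j) \<le> 1" "t j + s (j, i) \<le> 1"
      unfolding s_def t_def using False that a
      by (auto intro!: induced_matching_diagD[OF M] simp: link_def)
    then show ?thesis
      using False s01[of "(i, j)"] s01[of "(j, i)"] s01[of "(i, i)"] s01[of "(j, j)"]
      by (auto simp: t_def)
  qed
  have "sum t a = (\<Sum>i\<in>a. if t i = 1 then 1 else 0)"
    using s01 by (intro sum.cong) (auto simp: t_def)
  also have "\<dots> = real (card {i \<in> a. t i = 1})"
    using fin by (simp add: sum.inter_filter[symmetric])
  finally obtain m :: nat where m: "sum t a = real m" by blast
  \<comment> \<open>Integrality matters: the product is negative strictly between 1 and 2.\<close>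
  have T: "(real m - 1) * (real m - 2) \<ge> 0"
  proof (cases "m \<ge> 2")
    case False
    then have "m = 0 \<or> m = 1" by auto
    then show ?thesis by auto
  qed simp
  have "2 * sum s (a \<times> a) \<le> (\<Sum>i\<in>a. \<Sum>j\<in>a. 1 - t i * t j + (if i = j then 3 * t i - 1 else 0))"
    unfolding sum_square_symmetrize using bound by (intro sum_mono) auto
  also have "\<dots> \<le> real (card a) ^ 2 - real (card a) + 2"
    unfolding sum_square_profile[OF fin] m using T by simp
  finally show ?thesis unfolding s_def by simp
qed

text \<open>For \<open>i \<noteq> j\<close> exactly one of \<open>(i, j)\<close>,
  \<open>(j, i)\<close> is chosen unless both indices lie in \<open>b\<close>, when neither is;
  \<open>i < j\<close> breaks the tie if both lie outside \<open>b\<close>. One matching thus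
  attains the pairwise bounds for all \<open>a\<close> at once.\<close>

definition chosen_pairs :: "nat \<Rightarrow> nat set \<Rightarrow> (nat \<times> nat) set" where
  "chosen_pairs k b =
     {(i, j). i < k \<and> j < k \<and> (if i = j then i \<in> b else i \<notin> b \<and> (j \<in> b \<or> i < j))}"

definition set_matching :: "nat \<Rightarrow> nat set \<Rightarrow> nat set set" where
  "set_matching k b = (\<lambda>p. gedge p p) ` chosen_pairs k b"

lemma chosen_pairs_not_link:
  assumes "p \<in> chosen_pairs k b" "q \<in> chosen_pairs k b" "p \<noteq> q"
  shows "\<not> link p q"
proof
  assume "link p q"
  obtain i j where p: "p = (i, j)" by (cases p)
  consider "q = (j, i)" "i \<noteq> j" | l where "i = j" "q = (i, l)" "l \<noteq> i"
    using \<open>link p q\<close> assms(3) unfolding link_def p by (cases q) auto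
  then show False using assms(1,2) unfolding p by cases (auto simp: chosen_pairs_def)
qed

lemma induced_matching_set_matching: "induced_matching (gedges k) (set_matching k b)"
  unfolding induced_matching_def matching_def
proof (intro conjI ballI impI notI)
  show "set_matching k b \<subseteq> gedges k"
    by (auto simp: set_matching_def chosen_pairs_def gedges_def link_def)
next
  fix e1 e2 assume "e1 \<in> set_matching k b" "e2 \<in> set_matching k b" "e1 \<noteq> e2"
  then obtain p q where "e1 = gedge p p" "e2 = gedge q q" "p \<noteq> q" by (auto simp: set_matching_def)
  then show "e1 \<inter> e2 = {}" by (simp add: gedge_Int)
next
  fix e1 e2
  assume e: "e1 \<in> set_matching k b" "e2 \<in> set_matching k b" "e1 \<noteq> e2"
    and "\<exists>f\<in>gedges k. f \<inter> e1 \<noteq> {} \<and> f \<inter> e2 \<noteq> {}"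
  then obtain p q where f: "link p q" "gedge p q \<inter> e1 \<noteq> {}" "gedge p q \<inter> e2 \<noteq> {}"
    unfolding gedges_def by blast
  obtain r1 r2 where r: "r1 \<in> chosen_pairs k b" "r2 \<in> chosen_pairs k b" "r1 \<noteq> r2"
    "e1 = gedge r1 r1" "e2 = gedge r2 r2"
    using e unfolding set_matching_def by blast
  \<comment> \<open>An edge meeting two distinct diagonal edges has one end on each, so it would
    link two chosen pairs.\<close>
  have "p = r1 \<or> q = r1" "p = r2 \<or> q = r2"
    using f(2,3) unfolding r(4,5) gedge_Int by blast+
  then have "p = r1 \<and> q = r2 \<or> p = r2 \<and> q = r1"
    using r(3) by blast
  then show False using f(1) r(1-3) chosen_pairs_not_link by blast
qed

text \<open>The pairwise estimates behind \<open>induced_matching_square_le\<close> are equalities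
  here, with \<open>t\<close> the indicator of \<open>b\<close>.\<close>

lemma set_matching_square_eq:
  assumes a: "a \<subseteq> {..<k}"
  shows "(\<Sum>p\<in>a \<times> a. incidence (set_matching k b) (gedge p p)) =
    (real (card a) ^ 2 - real (card a) + 2 - (real (card (a \<inter> b)) - 1) * (real (card (a \<inter> b)) - 2)) / 2"
proof -
  have fin: "finite a" using a finite_subset by blast
  define s where "s p = incidence (set_matching k b) (gedge p p)" for p
  define t :: "nat \<Rightarrow> real" where "t i = (if i \<in> b then 1 else 0)" for i
  have s: "s p = (if p \<in> chosen_pairs k b then 1 else 0)" for p
    by (auto simp: s_def incidence_def set_matching_def gedge_eq_iff)
  have eq: "s (i, j) + s (j, i) = 1 - t i * t j + (if i = j then 3 * t i - 1 else 0)"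
    if "i \<in> a" "j \<in> a" for i j
  proof -
    have "i < k" "j < k" using that a by auto
    then show ?thesis
      by (cases i j rule: linorder_cases) (simp_all add: s t_def chosen_pairs_def)
  qed
  have "sum t a = real (card (a \<inter> b))"
    using fin by (simp add: t_def sum.If_cases)
  then have "2 * sum s (a \<times> a) = real (card a) ^ 2 - real (card a) + 2
      - (real (card (a \<inter> b)) - 1) * (real (card (a \<inter> b)) - 2)"
    unfolding sum_square_symmetrize using eq sum_square_profile[OF fin, of t] by simp
  then show ?thesis unfolding s_def by simp
qed

lemma xc_gedges: "3 ^ k \<le> (xc (induced_matching_polytope (gedges k)) + 1) * 2 ^ k"
proof -
  define X where "X = {incidence M | M. induced_matching (gedges k) M}"
  define w :: "nat set \<Rightarrow> nat set \<Rightarrow> real"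
    where "w a e = (if e \<in> (\<lambda>p. gedge p p) ` (a \<times> a) then 1 else 0)" for a e
  define \<delta> where "\<delta> a = (real (card a) ^ 2 - real (card a) + 2) / 2" for a :: "nat set"
  have "X \<subseteq> incidence ` Pow (gedges k)"
    by (auto simp: X_def induced_matching_def matching_def)
  then have "finite X" using finite_gedges finite_subset by blast
  then obtain d Q' M where Q': "polytope_in d Q'"
    "cvx_hull X = (\<lambda>x e. \<Sum>i<d. M e i * x i) ` Q'" "card {F. facet_in d F Q'} = xc (cvx_hull X)"
    by (rule xc_attained)
  have w: "(\<Sum>e\<in>gedges k. w a e * x e) = (\<Sum>p\<in>a \<times> a. x (gedge p p))" if "a \<subseteq> {..<k}" for a x
  proof -
    have sub: "(\<lambda>p. gedge p p) ` (a \<times> a) \<subseteq> gedges k"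
      using that unfolding gedges_def link_def by blast
    have "(\<Sum>e\<in>gedges k. w a e * x e) = (\<Sum>e\<in>(\<lambda>p. gedge p p) ` (a \<times> a). x e)"
      using sub finite_gedges by (intro sum.mono_neutral_cong_right) (auto simp: w_def)
    then show ?thesis by (simp add: sum.reindex[OF inj_gedge_diag])
  qed
  have pt: "incidence (set_matching k b) \<in> cvx_hull X" for b
    using cvx_hull_superset[of X] induced_matching_set_matching by (auto simp: X_def)
  have tight: "(\<Sum>e\<in>gedges k. w a e * incidence (set_matching k b) e) = \<delta> a \<longleftrightarrow> card (a \<inter> b) \<in> {1, 2}"
    if "a \<subseteq> {..<k}" for a b
    unfolding w[OF that] set_matching_square_eq[OF that] \<delta>_def by auto
  \<comment> \<open>For \<open>a = {}\<close> the inequality reads \<open>0 \<le> 1\<close> and is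
    never tight, so it defines no nonempty face.\<close>
  define A where "A = Pow {..<k} - {{}}"
  obtain RA RB where R: "\<And>F. RA F \<subseteq> A" "\<And>F. RB F \<subseteq> Pow {..<k}"
    "\<And>F a b. a \<in> RA F \<Longrightarrow> b \<in> RB F \<Longrightarrow> (\<Sum>e\<in>gedges k. w a e * incidence (set_matching k b) e) \<noteq> \<delta> a"
    "\<And>a b. a \<in> A \<Longrightarrow> b \<in> Pow {..<k} \<Longrightarrow> (\<Sum>e\<in>gedges k. w a e * incidence (set_matching k b) e) \<noteq> \<delta> a \<Longrightarrow>
       \<exists>F. facet_in d F Q' \<and> a \<in> RA F \<and> b \<in> RB F"
  proof (rule facets_cover_slack_support[OF Q'(1,2), where A = A and E = "gedges k" and w = w
        and \<delta> = \<delta> and B = "Pow {..<k}" and pt = "\<lambda>b. incidence (set_matching k b)"], goal_cases)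
    case (1 a x)
    then have a: "a \<subseteq> {..<k}" and x: "x \<in> cvx_hull X" by (simp_all add: A_def)
    show ?case
    proof (rule cvx_hull_le[OF x])
      fix p assume "p \<in> X"
      then obtain M where M: "induced_matching (gedges k) M" "p = incidence M" by (auto simp: X_def)
      show "(\<Sum>e\<in>gedges k. w a e * p e) \<le> \<delta> a"
        unfolding w[OF a] M(2) \<delta>_def using M(1) a by (rule induced_matching_square_le)
    qed
  next
    case (2 a)
    then obtain i where i: "i \<in> a" "a \<subseteq> {..<k}" by (auto simp: A_def)
    then have "card (a \<inter> {i}) \<in> {1, 2}" by simp
    then show ?case using tight[OF i(2)] pt[of "{i}"] by blast
  qed (use pt in auto)
  have "3 ^ card {..<k} \<le> (card {F. facet_in d F Q'} + 1) * 2 ^ card {..<k}"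
  proof (rule unique_disjointness_cover_bound[where RA = RA and RB = RB])
    show "RA F \<subseteq> Pow {..<k} \<and> RB F \<subseteq> Pow {..<k}" for F using R(1,2) by (auto simp: A_def)
    show "card (a \<inter> b) \<noteq> 1" if "a \<in> RA F" "b \<in> RB F" for F a b
      using R(3)[OF that] tight[of a b] R(1)[of F] that by (auto simp: A_def)
    show "\<exists>F\<in>{F. facet_in d F Q'}. a \<in> RA F \<and> b \<in> RB F"
      if "a \<subseteq> {..<k}" "b \<subseteq> {..<k}" "a \<noteq> {}" "a \<inter> b = {}" for a b
      using R(4)[of a b] tight[of a b] that by (auto simp: A_def)
  qed (use finite_facets[OF Q'(1)] in auto)
  then show ?thesis unfolding Q'(3) induced_matching_polytope_def X_def[symmetric] by simp
qed

theorem theorem3: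
  shows "\<exists>(C::nat) (c::real) (N0::nat). c > 0 \<and>
    (\<forall>n\<ge>N0. \<exists>V E. simple_graph V E \<and> bipartite V E \<and>
        card V \<le> C * n \<and> card E \<le> C * n \<and>
        real (xc (induced_matching_polytope E)) \<ge> 2 powr (c * root 4 (real n)))"
proof (rule exI[of _ 3], rule exI[of _ "1/4"], rule exI[of _ 1296], intro conjI allI impI)
  fix n :: nat assume n: "n \<ge> 1296"
  define r where "r = root 4 (real n)"
  define k where "k = nat \<lfloor>r\<rfloor>"
  \<comment> \<open>\<open>1296 = 6 ^ 4\<close>, and \<open>r \<ge> 6\<close> is what makes
    \<open>r / 4 \<le> (r - 1) / 2 - 1\<close>, where \<open>r - 1 < k\<close>.\<close>
  have "root 4 (6 ^ 4) \<le> r" unfolding r_def using n by (subst real_root_le_iff) auto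
  then have r6: "r \<ge> 6" by (simp add: real_root_power_cancel)
  have k: "real k \<le> r" "r < real k + 1" using r6 unfolding k_def by linarith+
  have "real (k * k) \<le> r ^ 2" using k(1) by (simp add: power2_eq_square mult_mono)
  also have "\<dots> \<le> r ^ 4" using r6 by (intro power_increasing) auto
  also have "\<dots> = real n" unfolding r_def by simp
  finally have kn: "k * k \<le> n" by linarith
  have "2 powr (1 / 4 * r) \<le> 2 powr (real k / 2 - 1)" using k r6 by (intro powr_mono) auto
  also have "\<dots> = sqrt 2 ^ k / 2"
    by (simp add: powr_diff powr_half_sqrt_powr powr_realpow real_sqrt_power flip: powr_powr)
  \<comment> \<open>Half of \<open>sqrt 2 ^ k\<close> is at least 1, which pays for the
    \<open>+ 1\<close> in \<open>xc_gedges\<close>.\<close>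
  also have "\<dots> \<le> sqrt 2 ^ k - 1"
  proof -
    have "sqrt 2 ^ 2 \<le> sqrt 2 ^ k" using k r6 by (intro power_increasing) auto
    then show ?thesis by simp
  qed
  also have "sqrt 2 ^ k \<le> (3 / 2) ^ k"
    by (intro power_mono real_le_lsqrt) (auto simp: power2_eq_square)
  also have "(3 / 2 :: real) ^ k - 1 \<le> xc (induced_matching_polytope (gedges k))"
  proof -
    have "real (3 ^ k) \<le> real ((xc (induced_matching_polytope (gedges k)) + 1) * 2 ^ k)"
      using xc_gedges by (intro of_nat_mono)
    then show ?thesis by (simp add: power_divide field_simps)
  qed
  finally have "2 powr (1 / 4 * root 4 (real n)) \<le> xc (induced_matching_polytope (gedges k))"
    unfolding r_def by simp
  moreover have "card (gverts k) \<le> 3 * n" "card (gedges k) \<le> 3 * n"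
    using card_gverts[of k] card_gedges[of k] kn by linarith+
  ultimately show "\<exists>V E. simple_graph V E \<and> bipartite V E \<and> card V \<le> 3 * n \<and> card E \<le> 3 * n \<and>
      real (xc (induced_matching_polytope E)) \<ge> 2 powr (1 / 4 * root 4 (real n))"
    using simple_graph_gverts_gedges bipartite_gverts_gedges by blast
qed simp

end
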